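(* Let $p,q,r\in(1,\infty)$ be such that $\frac{1}{r}=\frac{1}{p}+\frac{1}{q}$. Then the inclusion $$\Pi_{q}\circ\delta_{p}^{n}\subset\Pi_{r}^{n}$$ is valid for all natural numbers $n\ge\frac{p}{r}$. That is, for all such $n$ and all Banach spaces $X_1,\dots,X_n,Y,Z$, if $T\in\delta_p^n(X_1,\dots,X_n;Y)$ and $u\in\Pi_q(Y;Z)$, then $u\circ T\in\Pi_r^n(X_1,\dots,X_n;Z)$.
   Context: All Banach spaces are over $\mathbb{K}=\mathbb{R}$ or $\mathbb{C}$. For a Banach space $X$ with dual $X^*$ and $0<p<\infty$, $\ell_p(X)$ is the space of sequences $(x_j)$ in $X$ with $\sum_j\|x_j\|^p<\infty$, and $\ell_p^w(X)$ is the space of sequences $(x_j)$ in $X$ with $\sup_{\varphi\in B_{X^*}}\sum_j|\varphi(x_j)|^p<\infty$. For $1\le q<\infty$, $\Pi_q(Y;Z)$ is the set of absolutely $q$-summing linear operators: continuous linear $u:Y\to Z$ such that $(u(y_j))_j\in\ell_q(Z)$ whenever $(y_j)_j\in\ell_q^w(Y)$. If $0<p,q_1,\dots,q_n<\infty$ and $\frac1p\le\frac1{q_1}+\cdots+\frac1{q_n}$, a continuous $n$-linear operator $T:X_1\times\cdots\times X_n\to Y$ is absolutely $(p;q_1,\dots,q_n)$-summing, written $T\in\Pi_{(p;q_1,\dots,q_n)}^n(X_1,\dots,X_n;Y)$, if $(T(x_j^{(1)},\dots,x_j^{(n)}))_{j=1}^\infty\in\ell_p(Y)$ for all $(x_j^{(k)})_{j=1}^\infty\in\ell_{q_k}^w(X_k)$,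 $k=1,\dots,n$. Write $\Pi_r^n=\Pi_{(r;r,\dots,r)}^n$ and $\delta_p^n=\Pi_{(p/n;p,\dots,p)}^n$ (the $p$-dominated $n$-linear operators). *)

theory Defs
  imports "HOL-Analysis.Analysis" "HOL-Algebra.Module"
begin

text \<open>
  The spaces \<open>X\<^sub>1, \<dots>, X\<^sub>n\<close> form a family of length \<open>n\<close> of unrelated Banach spaces, so Banach
  spaces are records with an explicit carrier rather than types of class \<open>banach\<close>. The members
  of a family share a type of elements. This is no restriction, since every family of Banach
  spaces can be realised with carriers in a common type (their disjoint union).

  The scalar field is a type \<open>'k\<close> of class \<open>real_normed_field\<close>. The instances \<open>real\<close> and
  \<open>complex\<close> give the two scalar fields \<open>\<real>\<close> and \<open>\<complex>\<close>, and by Gelfand--Mazur there are no others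
  up to isometric isomorphism.
\<close>

record ('k, 'a) normed_space = "('k, 'a) module" +
  vnorm :: "'a \<Rightarrow> real"

definition scalar_field :: "'k::real_normed_field ring" where
  "scalar_field = \<lparr>carrier = UNIV, mult = (*), one = 1, zero = 0, add = (+)\<rparr>"

text \<open>The fields \<open>mult\<close> and \<open>one\<close> are inherited from the record type \<open>module\<close> and play no role.\<close>

definition scalar_space :: "('k::real_normed_field, 'k) normed_space" where
  "scalar_space = \<lparr>carrier = UNIV, mult = (*), one = 1, zero = 0, add = (+),
     smult = (*), vnorm = norm\<rparr>"

text \<open>
  The value outside the carrier is fixed because \<^locale>\<open>Metric_space\<close> requires nonnegativity and
  symmetry on the whole type.
\<close>

definition norm_dist :: "('k, 'a) normed_space \<Rightarrow> 'a \<Rightarrow> 'a \<Rightarrow> real" where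
  "norm_dist V x y =
     (if x \<in> carrier V \<and> y \<in> carrier V then vnorm V (x \<ominus>\<^bsub>V\<^esub> y) else 0)"

definition norm_topology :: "('k, 'a) normed_space \<Rightarrow> 'a topology" where
  "norm_topology V = Metric_space.mtopology (carrier V) (norm_dist V)"

locale normed_vector_space = Module.module scalar_field V
  for V :: "('k::real_normed_field, 'a) normed_space" +
  assumes vnorm_eq_0_iff: "x \<in> carrier V \<Longrightarrow> vnorm V x = 0 \<longleftrightarrow> x = \<zero>\<^bsub>V\<^esub>"
    and vnorm_triangle: "\<lbrakk>x \<in> carrier V; y \<in> carrier V\<rbrakk> \<Longrightarrow>
      vnorm V (x \<oplus>\<^bsub>V\<^esub> y) \<le> vnorm V x + vnorm V y"
    and vnorm_smult: "x \<in> carrier V \<Longrightarrow> vnorm V (c \<odot>\<^bsub>V\<^esub> x) = norm c * vnorm V x"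

locale banach_space = normed_vector_space +
  assumes complete: "Metric_space.mcomplete (carrier V) (norm_dist V)"

lemma scalar_field_simps [simp]:
  "carrier scalar_field = UNIV" "mult scalar_field = (*)" "one scalar_field = 1"
  "zero scalar_field = 0" "add scalar_field = (+)"
  by (simp_all add: scalar_field_def)

lemma scalar_space_simps [simp]:
  "carrier scalar_space = UNIV" "zero scalar_space = 0" "add scalar_space = (+)"
  "smult scalar_space = (*)" "vnorm scalar_space = norm"
  by (simp_all add: scalar_space_def)

context normed_vector_space
begin

lemma vnorm_a_inv:
  assumes x: "x \<in> carrier V"
  shows "vnorm V (\<ominus>\<^bsub>V\<^esub> x) = vnorm V x"
proof -
  have "(-1) \<odot>\<^bsub>V\<^esub> x \<oplus>\<^bsub>V\<^esub> x = ((-1) \<oplus>\<^bsub>scalar_field\<^esub> 1) \<odot>\<^bsub>V\<^esub> x"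
    using x smult_l_distr[of "-1" 1 x] smult_one[of x] by simp
  also have "\<dots> = \<zero>\<^bsub>V\<^esub>"
    using x smult_l_null[of x] by simp
  finally have "\<ominus>\<^bsub>V\<^esub> x = (-1) \<odot>\<^bsub>V\<^esub> x"
    using x smult_closed[of "-1" x] by (metis M.minus_equality UNIV_I scalar_field_simps(1))
  then show ?thesis
    using x by (simp add: vnorm_smult)
qed

lemma vnorm_nonneg:
  assumes x: "x \<in> carrier V"
  shows "0 \<le> vnorm V x"
proof -
  have "vnorm V (x \<oplus>\<^bsub>V\<^esub> \<ominus>\<^bsub>V\<^esub> x) \<le> vnorm V x + vnorm V (\<ominus>\<^bsub>V\<^esub> x)"
    using x by (intro vnorm_triangle) auto
  moreover have "vnorm V (x \<oplus>\<^bsub>V\<^esub> \<ominus>\<^bsub>V\<^esub> x) = 0"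
    using x by (simp add: M.r_neg vnorm_eq_0_iff)
  ultimately show ?thesis
    using x by (simp add: vnorm_a_inv)
qed

lemma Metric_space_norm_dist: "Metric_space (carrier V) (norm_dist V)"
proof
  show "0 \<le> norm_dist V x y" for x y
    by (simp add: norm_dist_def vnorm_nonneg)
  show "norm_dist V x y = norm_dist V y x" for x y
  proof (cases "x \<in> carrier V \<and> y \<in> carrier V")
    case True
    then have "x \<ominus>\<^bsub>V\<^esub> y = \<ominus>\<^bsub>V\<^esub> (y \<ominus>\<^bsub>V\<^esub> x)"
      by (simp add: a_minus_def M.minus_add M.a_comm)
    with True show ?thesis
      by (simp add: norm_dist_def vnorm_a_inv)
  qed (auto simp: norm_dist_def)
  show "norm_dist V x y = 0 \<longleftrightarrow> x = y" if "x \<in> carrier V" "y \<in> carrier V" for x y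
  proof -
    have "x \<ominus>\<^bsub>V\<^esub> y = \<zero>\<^bsub>V\<^esub> \<longleftrightarrow> x = y"
      using that by (metis a_minus_def M.a_inv_closed M.minus_equality M.minus_minus M.r_neg)
    then show ?thesis
      using that by (simp add: norm_dist_def vnorm_eq_0_iff)
  qed
  show "norm_dist V x z \<le> norm_dist V x y + norm_dist V y z"
    if "x \<in> carrier V" "y \<in> carrier V" "z \<in> carrier V" for x y z
  proof -
    have "x \<ominus>\<^bsub>V\<^esub> z = (x \<ominus>\<^bsub>V\<^esub> y) \<oplus>\<^bsub>V\<^esub> (y \<ominus>\<^bsub>V\<^esub> z)"
      using that by (simp add: a_minus_def M.a_assoc M.r_neg1 M.r_neg2)
    then show ?thesis
      using that by (simp add: norm_dist_def vnorm_triangle)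
  qed
qed

end

lemma normed_vector_space_scalar_space:
  "normed_vector_space (scalar_space :: ('k::real_normed_field, 'k) normed_space)"
proof -
  let ?V = "scalar_space :: ('k, 'k) normed_space"
  have 1: "abelian_group ?V"
    by (rule abelian_groupI) (auto simp: ac_simps intro: exI[of _ "- x" for x] left_minus)
  have 2: "cring (scalar_field :: 'k ring)"
    by (rule cringI, rule abelian_groupI)
      (auto simp: algebra_simps intro!: comm_monoidI intro: exI[of _ "- x" for x] left_minus)
  have "Module.module scalar_field ?V"
    by (rule moduleI) (auto simp: 1 2 algebra_simps)
  then show ?thesis
    by (intro normed_vector_space.intro normed_vector_space_axioms.intro)
      (auto simp: norm_triangle_ineq norm_mult)
qed

lemma norm_dist_scalar_space [simp]:
  "norm_dist (scalar_space :: ('k::real_normed_field, 'k) normed_space) = dist"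
proof (intro ext)
  fix x y :: 'k
  let ?V = "scalar_space :: ('k, 'k) normed_space"
  interpret normed_vector_space ?V
    by (rule normed_vector_space_scalar_space)
  have "\<ominus>\<^bsub>?V\<^esub> y = - y"
    by (rule M.minus_equality) auto
  then show "norm_dist ?V x y = dist x y"
    by (simp add: norm_dist_def a_minus_def dist_norm)
qed

lemma norm_topology_scalar_space [simp]:
  "norm_topology (scalar_space :: ('k::real_normed_field, 'k) normed_space) = euclidean"
  by (simp add: norm_topology_def)

lemma banach_space_scalar_space:
  "banach_space (scalar_space :: ('k::{real_normed_field, banach}, 'k) normed_space)"
  by (intro banach_space.intro normed_vector_space_scalar_space banach_space_axioms.intro)
    (simp add: complete_UNIV)

definition linear_operator ::
    "('k, 'a) normed_space \<Rightarrow> ('k, 'b) normed_space \<Rightarrow> ('a \<Rightarrow> 'b) \<Rightarrow> bool" where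
  "linear_operator V W f \<longleftrightarrow>
     f \<in> carrier V \<rightarrow> carrier W \<and>
     (\<forall>x\<in>carrier V. \<forall>y\<in>carrier V. f (x \<oplus>\<^bsub>V\<^esub> y) = f x \<oplus>\<^bsub>W\<^esub> f y) \<and>
     (\<forall>c. \<forall>x\<in>carrier V. f (c \<odot>\<^bsub>V\<^esub> x) = c \<odot>\<^bsub>W\<^esub> f x)"

text \<open>
  Operators are total functions of which only the values on the carrier (for multilinear
  operators, on the extensional product of the carriers) are relevant.
\<close>

definition cont_linear ::
    "('k, 'a) normed_space \<Rightarrow> ('k, 'b) normed_space \<Rightarrow> ('a \<Rightarrow> 'b) set" where
  "cont_linear V W =
     {u. linear_operator V W u \<and> continuous_map (norm_topology V) (norm_topology W) u}"

definition cont_multilinear ::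
    "nat \<Rightarrow> (nat \<Rightarrow> ('k, 'a) normed_space) \<Rightarrow> ('k, 'b) normed_space \<Rightarrow>
     ((nat \<Rightarrow> 'a) \<Rightarrow> 'b) set" where
  "cont_multilinear n X Y =
     {T. (\<forall>k\<in>{1..n}. \<forall>x \<in> (\<Pi>\<^sub>E i\<in>{1..n}. carrier (X i)).
            linear_operator (X k) Y (\<lambda>a. T (x(k := a)))) \<and>
         continuous_map (product_topology (\<lambda>i. norm_topology (X i)) {1..n})
           (norm_topology Y) T}"

definition dual_ball :: "('k::real_normed_field, 'a) normed_space \<Rightarrow> ('a \<Rightarrow> 'k) set" where
  "dual_ball V =
     {\<phi> \<in> cont_linear V scalar_space. \<forall>x\<in>carrier V. vnorm V x \<le> 1 \<longrightarrow> norm (\<phi> x) \<le> 1}"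

definition strong_l :: "real \<Rightarrow> ('k, 'a) normed_space \<Rightarrow> (nat \<Rightarrow> 'a) set" where
  "strong_l p V =
     {x. (\<forall>j. x j \<in> carrier V) \<and> summable (\<lambda>j. vnorm V (x j) powr p)}"

text \<open>The sum and the supremum are taken in \<open>[0, \<infinity>]\<close>.\<close>

definition weak_l :: "real \<Rightarrow> ('k::real_normed_field, 'a) normed_space \<Rightarrow> (nat \<Rightarrow> 'a) set" where
  "weak_l p V =
     {x. (\<forall>j. x j \<in> carrier V) \<and>
         (SUP \<phi>\<in>dual_ball V. \<Sum>j. ennreal (norm (\<phi> (x j)) powr p)) < \<infinity>}"

text \<open>
  The standing restrictions on the exponents are part of the following two definitions: the
  classes are empty for exponents for which they are not defined.
\<close>

definition summing ::
    "real \<Rightarrow> ('k::real_normed_field, 'a) normed_space \<Rightarrow> ('k, 'b) normed_space \<Rightarrow>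
     ('a \<Rightarrow> 'b) set" where
  "summing q Y Z =
     {u \<in> cont_linear Y Z. 1 \<le> q \<and> (\<forall>y\<in>weak_l q Y. (\<lambda>j. u (y j)) \<in> strong_l q Z)}"

definition multi_summing ::
    "real \<Rightarrow> (nat \<Rightarrow> real) \<Rightarrow> nat \<Rightarrow> (nat \<Rightarrow> ('k::real_normed_field, 'a) normed_space) \<Rightarrow>
     ('k, 'b) normed_space \<Rightarrow> ((nat \<Rightarrow> 'a) \<Rightarrow> 'b) set" where
  "multi_summing p q n X Y =
     {T \<in> cont_multilinear n X Y.
        0 < p \<and> (\<forall>k\<in>{1..n}. 0 < q k) \<and> 1 / p \<le> (\<Sum>k=1..n. 1 / q k) \<and>
        (\<forall>x. (\<forall>k\<in>{1..n}. x k \<in> weak_l (q k) (X k)) \<longrightarrow>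
           (\<lambda>j. T (\<lambda>k\<in>{1..n}. x k j)) \<in> strong_l p Y)}"

definition r_summing ::
    "real \<Rightarrow> nat \<Rightarrow> (nat \<Rightarrow> ('k::real_normed_field, 'a) normed_space) \<Rightarrow>
     ('k, 'b) normed_space \<Rightarrow> ((nat \<Rightarrow> 'a) \<Rightarrow> 'b) set" where
  "r_summing r n X Y = multi_summing r (\<lambda>_. r) n X Y"

definition dominated ::
    "real \<Rightarrow> nat \<Rightarrow> (nat \<Rightarrow> ('k::real_normed_field, 'a) normed_space) \<Rightarrow>
     ('k, 'b) normed_space \<Rightarrow> ((nat \<Rightarrow> 'a) \<Rightarrow> 'b) set" where
  "dominated p n X Y = multi_summing (p / real n) (\<lambda>_. p) n X Y"

end

theory Submission
  imports Defs
begin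

text \<open>
  The inclusion follows from the monotonicity of the sequence spaces in the exponent. Since \<open>1 / r = 1 / p + 1 / q\<close> forces
  \<open>r < p\<close>, every weakly \<open>r\<close>-summable sequence is weakly \<open>p\<close>-summable (\<open>weak_l_mono\<close>). A
  \<open>p\<close>-dominated operator \<open>T\<close> therefore maps weakly \<open>r\<close>-summable sequences to sequences in
  \<open>\<ell>\<^bsub>p/n\<^esub>(Y)\<close>, and the condition \<open>n \<ge> p / r\<close> says exactly that \<open>p / n \<le> r\<close>, so that these
  sequences lie in \<open>\<ell>\<^sub>r(Y)\<close> (\<open>strong_l_mono\<close>). The bounded operator \<open>u\<close> maps \<open>\<ell>\<^sub>r(Y)\<close> to \<open>\<ell>\<^sub>r(Z)\<close>
  (\<open>cont_linear_strong_l\<close>).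
\<close>

text \<open>
  A sequence in \<open>\<ell>\<^sub>s\<close> tends to zero, so its norms are eventually at most \<open>1\<close>, where raising the
  exponent makes the powers smaller.
\<close>

lemma strong_l_mono:
  fixes V :: "('k::real_normed_field, 'a) normed_space"
  assumes V: "normed_vector_space V" and s: "0 < s" "s \<le> t"
  shows "strong_l s V \<subseteq> strong_l t V"
proof
  fix x assume x: "x \<in> strong_l s V"
  then have car: "\<And>j. x j \<in> carrier V" and sum: "summable (\<lambda>j. vnorm V (x j) powr s)"
    by (auto simp: strong_l_def)
  have nonneg: "0 \<le> vnorm V (x j)" for j
    using normed_vector_space.vnorm_nonneg[OF V car] .
  have "eventually (\<lambda>j. vnorm V (x j) powr s < 1) sequentially"
    using order_tendstoD(2)[OF summable_LIMSEQ_zero[OF sum]] by simp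
  then have "eventually (\<lambda>j. norm (vnorm V (x j) powr t) \<le> vnorm V (x j) powr s) sequentially"
  proof eventually_elim
    case (elim j)
    have "vnorm V (x j) < 1"
      using elim powr_mono2[of s 1 "vnorm V (x j)"] s by (force simp: not_le)
    then show ?case
      using powr_mono'[of s t "vnorm V (x j)"] nonneg[of j] s by simp
  qed
  then have "summable (\<lambda>j. vnorm V (x j) powr t)"
    by (rule summable_comparison_test_ev[OF _ sum])
  with car show "x \<in> strong_l t V"
    by (simp add: strong_l_def)
qed

lemma ennreal_le_suminf:
  fixes f :: "nat \<Rightarrow> ennreal"
  shows "f j \<le> (\<Sum>j. f j)"
  using sum_le_suminf[of f "{j}"] by simp

text \<open>
  If \<open>m\<close> bounds all the sums \<open>\<Sum>\<^sub>j |\<phi> (x\<^sub>j)|\<^sup>s\<close>, it bounds every term, so replacing \<open>s\<close> by \<open>t \<ge> s\<close>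
  multiplies each sum by at most \<open>m\<close> to the power \<open>(t - s) / s\<close>, uniformly in \<open>\<phi>\<close>.
\<close>

lemma weak_l_mono:
  fixes V :: "('k::real_normed_field, 'a) normed_space"
  assumes s: "0 < s" "s \<le> t"
  shows "weak_l s V \<subseteq> weak_l t V"
proof
  fix x assume x: "x \<in> weak_l s V"
  then have car: "\<And>j. x j \<in> carrier V"
    and fin: "(SUP \<phi>\<in>dual_ball V. \<Sum>j. ennreal (norm (\<phi> (x j)) powr s)) < \<infinity>"
    by (auto simp: weak_l_def)
  obtain m where m: "0 \<le> m"
    and sup: "(SUP \<phi>\<in>dual_ball V. \<Sum>j. ennreal (norm (\<phi> (x j)) powr s)) = ennreal m"
    using fin[unfolded infinity_ennreal_def less_top_ennreal] by blast
  define C where "C = m powr ((t - s) / s)"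
  have "(\<Sum>j. ennreal (norm (\<phi> (x j)) powr t)) \<le> ennreal C * ennreal m"
    if \<phi>: "\<phi> \<in> dual_ball V" for \<phi>
  proof -
    have sum_le: "(\<Sum>j. ennreal (norm (\<phi> (x j)) powr s)) \<le> ennreal m"
      unfolding sup[symmetric] using \<phi> by (rule SUP_upper)
    have "norm (\<phi> (x j)) powr t \<le> C * norm (\<phi> (x j)) powr s" for j
    proof -
      have "ennreal (norm (\<phi> (x j)) powr s) \<le> (\<Sum>j. ennreal (norm (\<phi> (x j)) powr s))"
        by (rule ennreal_le_suminf)
      also note sum_le
      finally have le: "norm (\<phi> (x j)) powr s \<le> m"
        using m by simp
      have "norm (\<phi> (x j)) powr t = (norm (\<phi> (x j)) powr s) powr ((t - s) / s) * norm (\<phi> (x j)) powr s"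
        using s by (simp add: powr_powr powr_add[symmetric])
      also have "\<dots> \<le> C * norm (\<phi> (x j)) powr s"
        unfolding C_def using s le by (intro mult_right_mono powr_mono2) auto
      finally show ?thesis .
    qed
    then have "ennreal (norm (\<phi> (x j)) powr t) \<le> ennreal C * ennreal (norm (\<phi> (x j)) powr s)" for j
      by (simp add: ennreal_mult[symmetric] C_def)
    then have "(\<Sum>j. ennreal (norm (\<phi> (x j)) powr t))
        \<le> (\<Sum>j. ennreal C * ennreal (norm (\<phi> (x j)) powr s))"
      by (intro suminf_le) auto
    also have "\<dots> = ennreal C * (\<Sum>j. ennreal (norm (\<phi> (x j)) powr s))"
      by simp
    also have "\<dots> \<le> ennreal C * ennreal m"
      by (intro mult_left_mono sum_le) auto
    finally show ?thesis .
  qed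
  then have "(SUP \<phi>\<in>dual_ball V. \<Sum>j. ennreal (norm (\<phi> (x j)) powr t)) \<le> ennreal C * ennreal m"
    by (rule SUP_least)
  also have "\<dots> < \<infinity>"
    by (simp add: ennreal_mult_less_top)
  finally show "x \<in> weak_l t V"
    using car by (simp add: weak_l_def)
qed

text \<open>
  Continuity at zero gives \<open>d > 0\<close> such that \<open>\<parallel>u x\<parallel> < 1\<close> whenever \<open>\<parallel>x\<parallel> < d\<close>; a nonzero vector is
  rescaled to norm \<open>d / 2\<close> to bring it into this ball, which yields the bound \<open>2 / d\<close>.
\<close>

lemma cont_linear_bounded:
  fixes V :: "('k::real_normed_field, 'a) normed_space"
    and W :: "('k, 'b) normed_space"
  assumes V: "normed_vector_space V" and W: "normed_vector_space W"
    and u: "u \<in> cont_linear V W"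
  obtains C where "0 < C" "\<And>x. x \<in> carrier V \<Longrightarrow> vnorm W (u x) \<le> C * vnorm V x"
proof -
  interpret V: normed_vector_space V by (rule V)
  interpret W: normed_vector_space W by (rule W)
  interpret MV: Metric_space "carrier V" "norm_dist V" by (rule V.Metric_space_norm_dist)
  interpret MW: Metric_space "carrier W" "norm_dist W" by (rule W.Metric_space_norm_dist)
  have u_closed: "\<And>x. x \<in> carrier V \<Longrightarrow> u x \<in> carrier W"
    and u_smult: "\<And>c x. x \<in> carrier V \<Longrightarrow> u (c \<odot>\<^bsub>V\<^esub> x) = c \<odot>\<^bsub>W\<^esub> u x"
    and cont: "continuous_map MV.mtopology MW.mtopology u"
    using u by (auto simp: cont_linear_def linear_operator_def norm_topology_def)
  have dist_zero: "norm_dist V \<zero>\<^bsub>V\<^esub> x = vnorm V x" if "x \<in> carrier V" for x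
    using that by (simp add: norm_dist_def a_minus_def V.vnorm_a_inv)
  have dist_zero': "norm_dist W \<zero>\<^bsub>W\<^esub> x = vnorm W x" if "x \<in> carrier W" for x
    using that by (simp add: norm_dist_def a_minus_def W.vnorm_a_inv)
  have u_zero: "u \<zero>\<^bsub>V\<^esub> = \<zero>\<^bsub>W\<^esub>"
    using u_smult[of "\<zero>\<^bsub>V\<^esub>" 0] V.smult_l_null[of "\<zero>\<^bsub>V\<^esub>"] W.smult_l_null[of "u \<zero>\<^bsub>V\<^esub>"]
      u_closed[of "\<zero>\<^bsub>V\<^esub>"] by simp
  have "\<exists>d>0. \<forall>x. x \<in> carrier V \<and> norm_dist V \<zero>\<^bsub>V\<^esub> x < d \<longrightarrow>
      norm_dist W (u \<zero>\<^bsub>V\<^esub>) (u x) < 1"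
    using cont MV.metric_continuous_map[OF W.Metric_space_norm_dist, of u] V.zero_closed
      zero_less_one by blast
  then obtain d where d: "d > 0"
    and small: "\<And>x. x \<in> carrier V \<Longrightarrow> vnorm V x < d \<Longrightarrow> vnorm W (u x) < 1"
    by (auto simp: dist_zero dist_zero' u_closed u_zero)
  have "vnorm W (u x) \<le> 2 / d * vnorm V x" if x: "x \<in> carrier V" for x
  proof (cases "x = \<zero>\<^bsub>V\<^esub>")
    case True
    moreover have "vnorm V \<zero>\<^bsub>V\<^esub> = 0" "vnorm W \<zero>\<^bsub>W\<^esub> = 0"
      using V.vnorm_eq_0_iff[of "\<zero>\<^bsub>V\<^esub>"] W.vnorm_eq_0_iff[of "\<zero>\<^bsub>W\<^esub>"] by simp_all
    ultimately show ?thesis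
      by (simp add: u_zero)
  next
    case False
    then have pos: "0 < vnorm V x"
      using V.vnorm_nonneg[OF x] V.vnorm_eq_0_iff[OF x] by simp
    define c where "c = d / (2 * vnorm V x)"
    have c: "0 < c"
      using pos d by (simp add: c_def)
    have "vnorm V (of_real c \<odot>\<^bsub>V\<^esub> x) < d"
    proof -
      have "vnorm V (of_real c \<odot>\<^bsub>V\<^esub> x) = c * vnorm V x"
        using c x by (simp add: V.vnorm_smult)
      also have "\<dots> < d"
        using pos d by (simp add: c_def)
      finally show ?thesis .
    qed
    then have "vnorm W (u (of_real c \<odot>\<^bsub>V\<^esub> x)) < 1"
      using x V.smult_closed[of "of_real c" x] by (intro small) auto
    then have "c * vnorm W (u x) < 1"
      using x c u_closed by (simp add: u_smult W.vnorm_smult)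
    then show ?thesis
      using pos d by (simp add: c_def field_simps)
  qed
  then show thesis
    using d that[of "2 / d"] by simp
qed

lemma cont_linear_strong_l:
  fixes V :: "('k::real_normed_field, 'a) normed_space"
    and W :: "('k, 'b) normed_space"
  assumes V: "normed_vector_space V" and W: "normed_vector_space W"
    and u: "u \<in> cont_linear V W" and t: "0 < t" and x: "x \<in> strong_l t V"
  shows "(\<lambda>j. u (x j)) \<in> strong_l t W"
proof -
  have car: "\<And>j. x j \<in> carrier V" and sum: "summable (\<lambda>j. vnorm V (x j) powr t)"
    using x by (auto simp: strong_l_def)
  have u_car: "u (x j) \<in> carrier W" for j
    using u car by (auto simp: cont_linear_def linear_operator_def)
  obtain C where C: "0 < C" and bound: "\<And>x. x \<in> carrier V \<Longrightarrow> vnorm W (u x) \<le> C * vnorm V x"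
    using cont_linear_bounded[OF V W u] by blast
  have "norm (vnorm W (u (x j)) powr t) \<le> C powr t * vnorm V (x j) powr t" for j
    using powr_mono2[OF _ _ bound[OF car[of j]]] C t
      normed_vector_space.vnorm_nonneg[OF V car] normed_vector_space.vnorm_nonneg[OF W u_car]
    by (simp add: powr_mult)
  then have "summable (\<lambda>j. vnorm W (u (x j)) powr t)"
    by (intro summable_comparison_test'[OF summable_mult[OF sum]]) blast
  with u_car show ?thesis
    by (simp add: strong_l_def)
qed

lemma cont_linear_comp_multilinear:
  fixes X :: "nat \<Rightarrow> ('k::real_normed_field, 'a) normed_space"
    and Y :: "('k, 'b) normed_space" and Z :: "('k, 'c) normed_space"
  assumes u: "u \<in> cont_linear Y Z" and T: "T \<in> cont_multilinear n X Y"
  shows "u \<circ> T \<in> cont_multilinear n X Z"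
proof -
  have "linear_operator V Z (\<lambda>a. u (f a))"
    if "linear_operator V Y f" for f and V :: "('k, 'a) normed_space"
    using u that by (fastforce simp: cont_linear_def linear_operator_def Pi_iff)
  then show ?thesis
    using u T unfolding cont_linear_def cont_multilinear_def
    by (auto intro: continuous_map_compose)
qed

theorem corollary5p2:
  fixes p q r :: real and n :: nat
    and X :: "nat \<Rightarrow> ('k::real_normed_field, 'a) normed_space"
    and Y :: "('k, 'b) normed_space"
    and Z :: "('k, 'c) normed_space"
    and T :: "(nat \<Rightarrow> 'a) \<Rightarrow> 'b" and u :: "'b \<Rightarrow> 'c"
  assumes "1 < p" and "1 < q" and "1 < r"
    and "1 / r = 1 / p + 1 / q"
    and "p / r \<le> real n"
    and "\<And>k. k \<in> {1..n} \<Longrightarrow> banach_space (X k)"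
    and "banach_space Y" and "banach_space Z"
    and "T \<in> dominated p n X Y"
    and "u \<in> summing q Y Z"
  shows "u \<circ> T \<in> r_summing r n X Z"
proof -
  have Y: "normed_vector_space Y" and Z: "normed_vector_space Z"
    using assms(7,8) by (simp_all add: banach_space_def)
  have u: "u \<in> cont_linear Y Z"
    using assms(10) by (simp add: summing_def)
  have T: "T \<in> cont_multilinear n X Y"
    and T_sum: "\<And>x. \<forall>k\<in>{1..n}. x k \<in> weak_l p (X k) \<Longrightarrow>
      (\<lambda>j. T (\<lambda>k\<in>{1..n}. x k j)) \<in> strong_l (p / real n) Y"
    using assms(9) by (auto simp: dominated_def multi_summing_def)
  have n: "0 < n"
    using assms(1,3,5) by (cases n) (auto simp: field_simps)
  have "1 / p < 1 / r"
    using assms(2,4) by simp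
  then have "r \<le> p"
    using assms(1,3) by (simp add: field_simps)
  have exps: "0 < p / real n" "p / real n \<le> r"
    using assms(1,3,5) n by (simp_all add: field_simps)
  have "(\<lambda>j. (u \<circ> T) (\<lambda>k\<in>{1..n}. x k j)) \<in> strong_l r Z"
    if x: "\<forall>k\<in>{1..n}. x k \<in> weak_l r (X k)" for x
  proof -
    have "\<forall>k\<in>{1..n}. x k \<in> weak_l p (X k)"
      using x weak_l_mono[of r p] assms(3) \<open>r \<le> p\<close> by fastforce
    then have "(\<lambda>j. T (\<lambda>k\<in>{1..n}. x k j)) \<in> strong_l (p / real n) Y"
      by (rule T_sum)
    then have "(\<lambda>j. T (\<lambda>k\<in>{1..n}. x k j)) \<in> strong_l r Y"
      using strong_l_mono[OF Y exps] by blast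
    then show ?thesis
      using cont_linear_strong_l[OF Y Z u] assms(3) by simp
  qed
  moreover have "1 / r \<le> (\<Sum>k=1..n. 1 / r)"
    using n assms(3) by (simp add: field_simps)
  ultimately show ?thesis
    using cont_linear_comp_multilinear[OF u T] assms(3)
    by (simp add: r_summing_def multi_summing_def)
qed

end
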